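(* Let $\mathcal{H}$ be a complex Hilbert space and let $A$ be a bounded linear operator on $\mathcal{H}$. Then the following are equivalent: (i) for every $x\in\mathcal{H}$, one has $\|Ax\|=\|A^*x\|$ if and only if $A^*Ax=AA^*x$; (ii) $A$ is semi-normal.
   Context: The operator $A$ is called semi-normal if its self-commutator $C(A)=A^*A-AA^*$ is semi-definite, i.e. $C(A)\ge 0$ or $C(A)\le 0$. *)

theory Defs
  imports "HOL-Analysis.Analysis"
begin

(* A complex inner product space, with cinner linear in its first argument.  Building on
   real_inner makes the library's norm and topology available: x \<bullet> y is determined by
   cinner as its real part, so norm x = sqrt (Re (cinner x x)), and the library scaleR is
   determined by scaleC.  Positive definiteness of cinner is inherited from inner, see
   cinner_self below. *)
class complex_inner = real_inner +
  fixes scaleC :: "complex \<Rightarrow> 'a \<Rightarrow> 'a"  (infixr "*\<^sub>C" 75)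
    and cinner :: "'a \<Rightarrow> 'a \<Rightarrow> complex"
  assumes scaleC_add_right: "c *\<^sub>C (x + y) = c *\<^sub>C x + c *\<^sub>C y"
    and scaleC_add_left: "(c + d) *\<^sub>C x = c *\<^sub>C x + d *\<^sub>C x"
    and scaleC_scaleC: "c *\<^sub>C d *\<^sub>C x = (c * d) *\<^sub>C x"
    and scaleC_of_real: "complex_of_real r *\<^sub>C x = r *\<^sub>R x"
    and cinner_add_left: "cinner (x + y) z = cinner x z + cinner y z"
    and cinner_scaleC_left: "cinner (c *\<^sub>C x) y = c * cinner x y"
    and cinner_commute: "cinner x y = cnj (cinner y x)"
    and Re_cinner: "Re (cinner x y) = x \<bullet> y"

lemma cinner_self: "cinner x x = complex_of_real ((norm x)\<^sup>2)"
proof (rule complex_eqI)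
  show "Re (cinner x x) = Re (complex_of_real ((norm x)\<^sup>2))"
    by (simp add: Re_cinner power2_norm_eq_inner)
  have "Im (cinner x x) = - Im (cinner x x)"
    by (metis cinner_commute cnj.sel(2))
  then show "Im (cinner x x) = Im (complex_of_real ((norm x)\<^sup>2))"
    by simp
qed

class chilbert_space = complex_inner + complete_space

instantiation complex :: chilbert_space
begin

definition scaleC_complex :: "complex \<Rightarrow> complex \<Rightarrow> complex"
  where "scaleC_complex c z = c * z"

definition cinner_complex :: "complex \<Rightarrow> complex \<Rightarrow> complex"
  where "cinner_complex z w = z * cnj w"

instance
  by standard
    (simp_all add: scaleC_complex_def cinner_complex_def algebra_simps scaleR_conv_of_real
      inner_complex_def)

end

locale bounded_clinear = bounded_linear f
  for f :: "'a::complex_inner \<Rightarrow> 'b::complex_inner" +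
  assumes scaleC: "f (c *\<^sub>C x) = c *\<^sub>C f x"

(* The choice is the analogue of the library's adjoint for real inner products; for bounded
   operators on Hilbert spaces the chosen function exists (Riesz) and is unique. *)
definition cadjoint :: "('a::complex_inner \<Rightarrow> 'b::complex_inner) \<Rightarrow> 'b \<Rightarrow> 'a"
  where "cadjoint f = (SOME g. \<forall>x y. cinner (f x) y = cinner x (g y))"

definition self_commutator :: "('a::complex_inner \<Rightarrow> 'a) \<Rightarrow> 'a \<Rightarrow> 'a"
  where "self_commutator A = (\<lambda>x. cadjoint A (A x) - A (cadjoint A x))"

(* T \<ge> 0: the quadratic form of T takes only real nonnegative values. *)
definition nonneg_op :: "('a::complex_inner \<Rightarrow> 'a) \<Rightarrow> bool"
  where "nonneg_op T \<longleftrightarrow> (\<forall>x. cinner (T x) x \<in> \<real>\<^sub>\<ge>\<^sub>0)"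

(* T \<le> 0 is read as - T \<ge> 0. *)
definition semi_definite :: "('a::complex_inner \<Rightarrow> 'a) \<Rightarrow> bool"
  where "semi_definite T \<longleftrightarrow> nonneg_op T \<or> nonneg_op (\<lambda>x. - T x)"

definition semi_normal :: "('a::complex_inner \<Rightarrow> 'a) \<Rightarrow> bool"
  where "semi_normal A \<longleftrightarrow> semi_definite (self_commutator A)"

end

theory Submission
  imports Defs
begin

text \<open>
  Let \<open>C\<close> be the self-commutator of \<open>A\<close>.  Since
  \<open>\<langle>C x, x\<rangle> = \<parallel>A x\<parallel>\<^sup>2 - \<parallel>A\<^sup>* x\<parallel>\<^sup>2\<close>, condition (i) says that the quadratic form
  \<open>q x = \<langle>C x, x\<rangle>\<close> vanishes only on the kernel of \<open>C\<close>, and (ii) says that \<open>q\<close> does not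
  change sign.  These are equivalent for every symmetric linear operator on a real inner
  product space (\<open>symmetric_form_semidefinite_iff\<close>), here the underlying real one.
  If \<open>q \<ge> 0\<close> and \<open>q x = 0\<close>, then the nonnegative quadratic
  polynomial \<open>q (x + t C x)\<close> in \<open>t\<close> has the linear coefficient \<open>2 \<parallel>C x\<parallel>\<^sup>2\<close>, which must
  therefore be zero.  Conversely, if \<open>q x > 0 > q y\<close>, then \<open>q\<close> has a zero
  \<open>u = (1 - s) x + s y\<close> on the segment from \<open>x\<close> to \<open>y\<close>; if \<open>C u\<close> were zero, pairing it with
  the vector \<open>(1 - s) x - s y\<close> would give \<open>(1 - s)\<^sup>2 q x = s\<^sup>2 q y\<close>, which is impossible.

  For this to apply, \<open>cadjoint A\<close> must satisfy its defining identity.  Existence of the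
  adjoint is derived from the Riesz representation theorem, which is proved by minimising
  \<open>\<parallel>x\<parallel>\<^sup>2 - 2 f x\<close> (\<open>riesz_representation\<close>).
\<close>

text \<open>Near \<open>t = 0\<close> the linear term dominates, so it would make the polynomial change sign.\<close>

lemma nonneg_quadratic_imp_linear_coeff_0:
  fixes b c :: real
  assumes "\<And>t. 0 \<le> 2 * t * b + t\<^sup>2 * c"
  shows "b = 0"
proof (rule ccontr)
  assume "b \<noteq> 0"
  define d where "d = 1 + \<bar>c\<bar>"
  have d: "d > 0" "c < d" by (auto simp: d_def)
  have "2 * (- b / d) * b + (- b / d)\<^sup>2 * c = (b / d)\<^sup>2 * (c - 2 * d)"
    using d by (simp add: field_simps power2_eq_square)
  also have "\<dots> < 0"
    using d \<open>b \<noteq> 0\<close> by (intro mult_pos_neg) auto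
  finally show False
    using assms[of "- b / d"] by simp
qed

text \<open>
  The functional \<open>J\<close> below equals \<open>\<parallel>x - z\<parallel>\<^sup>2 - \<parallel>z\<parallel>\<^sup>2\<close> when \<open>z\<close> represents \<open>f\<close>, so \<open>z\<close> can
  only be its minimiser.  Minimising sequences are Cauchy by the parallelogram law.
\<close>

lemma riesz_representation:
  fixes f :: "'a::{real_inner, complete_space} \<Rightarrow> real"
  assumes "bounded_linear f"
  obtains z where "\<And>x. f x = x \<bullet> z"
proof -
  interpret f: bounded_linear f by fact
  obtain K where K: "\<And>x. norm (f x) \<le> norm x * K"
    using f.bounded by blast
  define J where "J x = (norm x)\<^sup>2 - 2 * f x" for x
  have "- K\<^sup>2 \<le> J x" for x
  proof -
    have "f x \<le> norm x * K"
      using K[of x] by simp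
    moreover have "0 \<le> (norm x - K)\<^sup>2" by simp
    ultimately show ?thesis
      by (simp add: J_def power2_diff)
  qed
  then have bdd: "bdd_below (range J)"
    by (auto intro: bdd_belowI[of _ "- K\<^sup>2"])
  define m where "m = Inf (range J)"
  have m_le: "m \<le> J x" for x
    unfolding m_def by (intro cInf_lower bdd) auto
  have "\<exists>x. J x < m + 1 / real (Suc n)" for n
    using cInf_lessD[of "range J" "m + 1 / real (Suc n)"] unfolding m_def by auto
  then obtain X where X: "\<And>n. J (X n) < m + 1 / real (Suc n)"
    by metis
  have parallelogram: "(norm (x - y))\<^sup>2 \<le> 2 * (J x - m) + 2 * (J y - m)" for x y
  proof -
    have "(norm (x - y))\<^sup>2 = 2 * J x + 2 * J y - 4 * J ((1/2) *\<^sub>R (x + y))"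
      unfolding J_def power2_norm_eq_inner
      by (simp add: f.scaleR f.add inner_simps inner_commute algebra_simps)
    then show ?thesis
      using m_le[of "(1/2) *\<^sub>R (x + y)"] by simp
  qed
  have "Cauchy X"
  proof (rule metric_CauchyI)
    fix e :: real
    assume "0 < e"
    obtain N where N: "4 / e\<^sup>2 < real (Suc N)"
      by (meson reals_Archimedean2 less_trans lessI of_nat_less_iff)
    have *: "J (X n) - m < e\<^sup>2 / 4" if "n \<ge> N" for n
    proof -
      have "4 / e\<^sup>2 < real (Suc n)"
        using N that by simp
      then have "1 / real (Suc n) < e\<^sup>2 / 4"
        using \<open>0 < e\<close> by (simp add: field_simps del: of_nat_Suc)
      then show ?thesis
        using X[of n] by linarith
    qed
    have "dist (X i) (X j) < e" if "i \<ge> N" "j \<ge> N" for i j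
    proof -
      have "(norm (X i - X j))\<^sup>2 < e\<^sup>2"
        using parallelogram[of "X i" "X j"] *[OF that(1)] *[OF that(2)] by argo
      then show ?thesis
        using \<open>0 < e\<close> by (simp add: dist_norm power_less_imp_less_base)
    qed
    then show "\<exists>M. \<forall>i\<ge>M. \<forall>j\<ge>M. dist (X i) (X j) < e" by blast
  qed
  then obtain z where z: "X \<longlonglongrightarrow> z"
    using Cauchy_convergent_iff convergent_def by blast
  have "(\<lambda>n. J (X n)) \<longlonglongrightarrow> J z"
    unfolding J_def by (intro tendsto_intros z f.tendsto)
  moreover have "(\<lambda>n. m + 1 / real (Suc n)) \<longlonglongrightarrow> m + 0"
    by (intro tendsto_add tendsto_const LIMSEQ_Suc[OF lim_1_over_n])
  ultimately have "J z \<le> m + 0"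
    using X by (intro LIMSEQ_le) (auto intro!: exI[of _ 0] less_imp_le)
  then have z_min: "J z \<le> J x" for x
    using m_le[of x] by simp
  have "f x = x \<bullet> z" for x
  proof -
    have "0 \<le> 2 * t * (x \<bullet> z - f x) + t\<^sup>2 * (x \<bullet> x)" for t
      using z_min[of "z + t *\<^sub>R x"] unfolding J_def power2_norm_eq_inner
      by (simp add: f.add f.scaleR inner_simps inner_commute power2_eq_square algebra_simps)
    from nonneg_quadratic_imp_linear_coeff_0[OF this] show ?thesis by simp
  qed
  then show ?thesis by (rule that)
qed

lemma symmetric_form_nonneg_imp_kernel:
  fixes T :: "'a::real_inner \<Rightarrow> 'a"
  assumes "linear T" and sym: "\<And>x y. T x \<bullet> y = x \<bullet> T y"
    and nonneg: "\<And>x. 0 \<le> T x \<bullet> x" and "T x \<bullet> x = 0"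
  shows "T x = 0"
proof -
  interpret T: linear T by fact
  have "0 \<le> 2 * t * (T x \<bullet> T x) + t\<^sup>2 * (T (T x) \<bullet> T x)" for t
    using nonneg[of "x + t *\<^sub>R T x"] \<open>T x \<bullet> x = 0\<close> sym[of "T x" x]
    by (simp add: T.add T.scaleR inner_simps power2_eq_square algebra_simps)
  from nonneg_quadratic_imp_linear_coeff_0[OF this] show ?thesis by simp
qed

lemma symmetric_form_semidefinite_iff:
  fixes T :: "'a::real_inner \<Rightarrow> 'a"
  assumes "linear T" and sym: "\<And>x y. T x \<bullet> y = x \<bullet> T y"
  shows "(\<forall>x. T x \<bullet> x = 0 \<longrightarrow> T x = 0) \<longleftrightarrow> (\<forall>x. 0 \<le> T x \<bullet> x) \<or> (\<forall>x. T x \<bullet> x \<le> 0)"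
    (is "?kernel \<longleftrightarrow> ?semidefinite")
proof
  interpret T: linear T by fact
  assume kernel: ?kernel
  show ?semidefinite
  proof (rule ccontr)
    assume "\<not> ?semidefinite"
    then obtain x y where x: "T x \<bullet> x > 0" and y: "T y \<bullet> y < 0"
      by (auto simp: not_le)
    define u where "u s = (1 - s) *\<^sub>R x + s *\<^sub>R y" for s :: real
    have Tu: "T (u s) = (1 - s) *\<^sub>R T x + s *\<^sub>R T y" for s
      by (simp add: u_def T.add T.scaleR)
    have cont: "continuous_on {0..1} (\<lambda>s. T (u s) \<bullet> u s)"
      unfolding Tu unfolding u_def by (intro continuous_intros)
    have "T (u 1) \<bullet> u 1 \<le> 0" "0 \<le> T (u 0) \<bullet> u 0"
      using x y by (simp_all add: u_def)
    from IVT2'[OF this _ cont] obtain s where s: "T (u s) \<bullet> u s = 0"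
      by auto
    then have "T (u s) = 0"
      using kernel by blast
    then have "0 = T (u s) \<bullet> ((1 - s) *\<^sub>R x - s *\<^sub>R y)"
      by simp
    also have "\<dots> = (1 - s)\<^sup>2 * (T x \<bullet> x) - s\<^sup>2 * (T y \<bullet> y)"
      unfolding Tu using sym[of x y]
      by (simp add: inner_simps inner_commute power2_eq_square algebra_simps)
    also have "\<dots> > 0"
    proof (cases "s = 0")
      case True
      then show ?thesis using x by simp
    next
      case False
      then have "s\<^sup>2 * (T y \<bullet> y) < 0" using y by (intro mult_pos_neg) auto
      moreover have "0 \<le> (1 - s)\<^sup>2 * (T x \<bullet> x)" using x by simp
      ultimately show ?thesis by linarith
    qed
    finally show False by simp
  qed
next
  assume ?semidefinite
  then show ?kernel
  proof
    assume "\<forall>x. 0 \<le> T x \<bullet> x"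
    then show ?thesis
      using symmetric_form_nonneg_imp_kernel[OF assms] by blast
  next
    assume "\<forall>x. T x \<bullet> x \<le> 0"
    then show ?thesis
      using symmetric_form_nonneg_imp_kernel[of "\<lambda>x. - T x"] linear_compose_neg[OF \<open>linear T\<close>] sym
      by simp
  qed
qed

text \<open>This recovers the whole complex inner product from its real part.\<close>

lemma Im_cinner: "Im (cinner x y) = - ((\<i> *\<^sub>C x) \<bullet> y)"
  by (simp add: cinner_scaleC_left flip: Re_cinner)

text \<open>
  The Riesz theorem gives an adjoint for the real inner product; complex linearity of \<open>A\<close>
  makes the imaginary parts agree as well.
\<close>

lemma cinner_cadjoint:
  fixes A :: "'a::chilbert_space \<Rightarrow> 'b::complex_inner"
  assumes "bounded_clinear A"
  shows "cinner (A x) y = cinner x (cadjoint A y)"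
proof -
  interpret A: bounded_clinear A by fact
  have "\<exists>z. \<forall>x. A x \<bullet> y = x \<bullet> z" for y
    using riesz_representation[of "\<lambda>x. A x \<bullet> y"]
      bounded_linear_compose[OF bounded_linear_inner_left A.bounded_linear_axioms]
    by blast
  then obtain g where g: "\<And>x y. A x \<bullet> y = x \<bullet> g y"
    by metis
  have "cinner (A x) y = cinner x (g y)" for x y
    by (rule complex_eqI) (simp_all add: Re_cinner Im_cinner g flip: A.scaleC)
  then have "\<forall>x y. cinner (A x) y = cinner x (cadjoint A y)"
    unfolding cadjoint_def
    by (intro someI[where P = "\<lambda>g. \<forall>x y. cinner (A x) y = cinner x (g y)" and x = g]) blast
  then show ?thesis by blast
qed

lemma linear_self_commutator:
  fixes A :: "'a::chilbert_space \<Rightarrow> 'a"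
  assumes "bounded_clinear A"
  shows "linear (self_commutator A)"
proof -
  interpret A: bounded_clinear A by fact
  have adj: "x \<bullet> cadjoint A y = A x \<bullet> y" for x y
    by (simp add: cinner_cadjoint[OF assms] flip: Re_cinner)
  have lin: "linear (cadjoint A)"
    by (rule linearI; rule vector_eq_ldot[THEN iffD1]) (simp_all add: adj inner_add_right)
  show ?thesis
    using linear_compose_sub[OF linear_compose[OF A.linear_axioms lin]
        linear_compose[OF lin A.linear_axioms]]
    by (simp add: self_commutator_def o_def)
qed

lemma self_commutator_symmetric:
  fixes A :: "'a::chilbert_space \<Rightarrow> 'a"
  assumes "bounded_clinear A"
  shows "self_commutator A x \<bullet> y = x \<bullet> self_commutator A y"
proof -
  have adj: "A x \<bullet> y = x \<bullet> cadjoint A y" for x y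
    by (simp add: cinner_cadjoint[OF assms] flip: Re_cinner)
  have "cadjoint A x \<bullet> y = x \<bullet> A y" for x y
    by (metis adj inner_commute)
  with adj show ?thesis
    by (simp add: self_commutator_def inner_simps)
qed

lemma cinner_diff_left: "cinner (x - y) z = cinner x z - cinner y z"
  using cinner_add_left[of "x - y" y z] by (simp add: algebra_simps)

lemma cinner_self_commutator:
  fixes A :: "'a::chilbert_space \<Rightarrow> 'a"
  assumes "bounded_clinear A"
  shows "cinner (self_commutator A x) x = of_real ((norm (A x))\<^sup>2 - (norm (cadjoint A x))\<^sup>2)"
proof -
  note adj = cinner_cadjoint[OF assms]
  have "cinner (cadjoint A (A x)) x = cnj (cinner (A x) (A x))"
    by (metis adj cinner_commute)
  then show ?thesis
    by (simp add: self_commutator_def cinner_diff_left adj cinner_self)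
qed

theorem mainTheorem2:
  fixes A :: "'a::chilbert_space \<Rightarrow> 'a"
  assumes "bounded_clinear A"
  shows "(\<forall>x. norm (A x) = norm (cadjoint A x) \<longleftrightarrow> cadjoint A (A x) = A (cadjoint A x))
    \<longleftrightarrow> semi_normal A"
proof -
  define C where "C = self_commutator A"
  have form: "cinner (C x) x = of_real ((norm (A x))\<^sup>2 - (norm (cadjoint A x))\<^sup>2)" for x
    unfolding C_def by (rule cinner_self_commutator[OF assms])
  then have re: "C x \<bullet> x = (norm (A x))\<^sup>2 - (norm (cadjoint A x))\<^sup>2" for x
    by (simp flip: Re_cinner)
  have form_eq: "cinner (C x) x = of_real (C x \<bullet> x)" for x
    by (simp only: form re)
  have neg_form_eq: "cinner (- C x) x = of_real (- (C x \<bullet> x))" for x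
    using cinner_diff_left[of 0 "C x" x] cinner_diff_left[of 0 0 x] by (simp add: form_eq)
  have "semi_normal A \<longleftrightarrow> (\<forall>x. 0 \<le> C x \<bullet> x) \<or> (\<forall>x. C x \<bullet> x \<le> 0)"
    unfolding semi_normal_def semi_definite_def nonneg_op_def C_def[symmetric] neg_form_eq form_eq
    by (simp add: complex_nonneg_Reals_iff)
  also have "\<dots> \<longleftrightarrow> (\<forall>x. C x \<bullet> x = 0 \<longrightarrow> C x = 0)"
    unfolding C_def
    by (rule symmetric_form_semidefinite_iff[OF linear_self_commutator[OF assms]
          self_commutator_symmetric[OF assms], symmetric])
  also have "\<dots> \<longleftrightarrow> (\<forall>x. C x \<bullet> x = 0 \<longleftrightarrow> C x = 0)"
    by auto
  also have "\<dots> \<longleftrightarrow>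
    (\<forall>x. norm (A x) = norm (cadjoint A x) \<longleftrightarrow> cadjoint A (A x) = A (cadjoint A x))"
  proof -
    have "C x \<bullet> x = 0 \<longleftrightarrow> norm (A x) = norm (cadjoint A x)" for x
      by (simp add: re)
    moreover have "C x = 0 \<longleftrightarrow> cadjoint A (A x) = A (cadjoint A x)" for x
      by (simp add: C_def self_commutator_def)
    ultimately show ?thesis by simp
  qed
  finally show ?thesis by blast
qed

end
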